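(* Let $k\in\mathbb{Z}_+$ and let $\Delta(\lambda)$ be a rectangular simplex, $\lambda=(\lambda_1,\dots,\lambda_n)\in\mathbb{Z}_+^n$. The following are equivalent: (1) $\Delta(\lambda)$ has the $\mathrm{LPE}(k)$ property. (2) For all $i,j \in \{1,\dots,n\}$ (not necessarily distinct), $\gcd(\lambda_i,\lambda_j) \ge k-1$.
   Context: $\mathbb{Z}_+$ is the set of positive integers. The rectangular simplex $\Delta(\lambda) \subset \mathbb{R}^n$ is the convex hull of $\{0,\lambda_1 e_1,\dots,\lambda_n e_n\}$. A lattice polytope has the $\mathrm{LPE}(k)$ property if each of its edges contains at least $k$ lattice points (endpoints included). *)

theory Defs
  imports "HOL-Analysis.Analysis"
begin

definition lattice_points :: "(real ^ 'n) set"
  where "lattice_points = {x. \<forall>i. x $ i \<in> \<int>}"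

definition lattice_polytope :: "(real ^ 'n) set \<Rightarrow> bool"
  where "lattice_polytope P \<longleftrightarrow>
    (\<exists>V. finite V \<and> V \<subseteq> lattice_points \<and> P = convex hull V)"

definition rect_simplex :: "nat ^ 'n \<Rightarrow> (real ^ 'n) set"
  where "rect_simplex l =
    convex hull (insert 0 (range (\<lambda>i. real (l $ i) *\<^sub>R axis i 1)))"

text \<open>An edge of a polytope is bounded and so contains only finitely many lattice points;
  hence the convention that infinite sets have cardinality 0 plays no role here.
  If the polytope has dimension one, it is itself its only edge.\<close>

definition LPE :: "nat \<Rightarrow> (real ^ 'n) set \<Rightarrow> bool"
  where "LPE k P \<longleftrightarrow>
    lattice_polytope P \<and> (\<forall>e. e edge_of P \<longrightarrow> card (e \<inter> lattice_points) \<ge> k)"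

end

theory Submission
  imports Defs
begin

text \<open>The hypothesis makes \<open>t\<close> rational unless \<open>V\<close> is trivial, and its reduced denominator
  then divides every element of \<open>V\<close>; this also covers infinite \<open>V\<close>.\<close>

lemma int_multiple_Gcd:
  fixes V :: "int set" and t :: real
  assumes "V \<noteq> {}" and mult: "\<And>v. v \<in> V \<Longrightarrow> t * of_int v \<in> \<int>"
  shows "t * of_int (Gcd V) \<in> \<int>"
proof (cases "V \<subseteq> {0}")
  case True
  then have "V = {0}" using assms(1) by auto
  then show ?thesis by simp
next
  case False
  then obtain v where v: "v \<in> V" "v \<noteq> 0" by auto
  obtain z where z: "t * of_int v = of_int z"
    using mult[OF v(1)] by (auto elim: Ints_cases)
  then have "t = of_int z / of_int v" using v by (simp add: field_simps)
  then have "t \<in> \<rat>" by simp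
  then obtain p q :: int where pq: "q > 0" "coprime p q" "t = of_int p / of_int q"
    by (metis Rats_cases' of_rat_divide of_rat_of_int_eq)
  have "q dvd w" if w: "w \<in> V" for w
  proof -
    obtain z where "t * of_int w = of_int z"
      using mult[OF w] by (auto elim: Ints_cases)
    then have "real_of_int (p * w) = of_int (q * z)"
      using pq by (simp add: field_simps)
    then have "q dvd p * w" by (metis of_int_eq_iff dvd_triv_left)
    then show ?thesis
      using pq(2) by (simp add: coprime_commute coprime_dvd_mult_right_iff)
  qed
  then have "q dvd Gcd V" by (rule Gcd_greatest)
  then obtain c where "Gcd V = q * c" ..
  then have "t * of_int (Gcd V) = of_int (p * c)" using pq by simp
  then show ?thesis by (metis Ints_of_int)
qed

text \<open>With \<open>g = Gcd (range v)\<close>, the point \<open>a + t *\<^sub>R (b - a)\<close>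
  is a lattice point iff \<open>t * g\<close> is an integer: one direction is
  \<open>int_multiple_Gcd\<close>, the other holds because \<open>g\<close> divides every
  \<open>v i\<close>. For \<open>a \<noteq> b\<close> the admissible parameters in the unit interval
  are therefore the \<open>m / g\<close> with \<open>0 \<le> m \<le> g\<close>, and both endpoints
  count, hence the \<open>Suc\<close>. For \<open>a = b\<close> the Gcd is 0 and the formula gives
  the single point.\<close>

lemma card_lattice_points_closed_segment:
  fixes a b :: "real ^ 'n" and v :: "'n \<Rightarrow> int"
  assumes a: "a \<in> lattice_points" and b: "\<And>i. b $ i = a $ i + of_int (v i)"
  shows "card (closed_segment a b \<inter> lattice_points) = Suc (nat (Gcd (range v)))"
proof (cases "a = b")
  case True
  then have "v i = 0" for i using b[of i] by simp
  then have "range v = {0}" by auto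
  then show ?thesis using True a by simp
next
  case False
  define g where "g = Gcd (range v)"
  have "g \<noteq> 0"
  proof
    assume "g = 0"
    then have "v i = 0" for i unfolding g_def Gcd_0_iff by auto
    then show False using False b by (simp add: vec_eq_iff)
  qed
  then have g: "g > 0" unfolding g_def by (simp add: order_less_le)
  text \<open>The segment is cut into \<open>g\<close> steps by the primitive vector \<open>(b - a) / g\<close>.\<close>
  define f where "f m = a + (of_int m / of_int g) *\<^sub>R (b - a)" for m :: int
  have "closed_segment a b \<inter> lattice_points = f ` {0..g}"
  proof (intro equalityI subsetI)
    fix x assume x: "x \<in> closed_segment a b \<inter> lattice_points"
    then obtain t where t: "0 \<le> t" "t \<le> 1" "x = a + t *\<^sub>R (b - a)"
      by (auto simp: closed_segment_def algebra_simps)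
    have "t * of_int (v i) \<in> \<int>" for i
    proof -
      have "t * of_int (v i) = x $ i - a $ i" by (simp add: t(3) b)
      then show ?thesis using x a by (simp add: lattice_points_def)
    qed
    then have "t * of_int g \<in> \<int>" unfolding g_def by (intro int_multiple_Gcd) auto
    then obtain m where m: "t * of_int g = of_int m" by (auto elim: Ints_cases)
    then have "real_of_int m \<ge> 0" "real_of_int m \<le> of_int g"
      using t g by (auto simp flip: m simp: mult_left_le_one_le)
    moreover have "t = of_int m / of_int g" using m g by (simp add: field_simps)
    ultimately show "x \<in> f ` {0..g}" using t(3) by (auto simp: f_def)
  next
    fix x assume "x \<in> f ` {0..g}"
    then obtain m where m: "0 \<le> m" "m \<le> g" "x = f m" by auto
    define t where "t = real_of_int m / of_int g"
    have "0 \<le> t" "t \<le> 1" using m g by (auto simp: t_def)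
    moreover have "x = (1 - t) *\<^sub>R a + t *\<^sub>R b"
      by (simp add: m(3) f_def t_def algebra_simps)
    ultimately have "x \<in> closed_segment a b" by (auto simp: closed_segment_def)
    moreover have "x $ i \<in> \<int>" for i
    proof -
      have "g dvd v i" unfolding g_def by (rule Gcd_dvd) simp
      then obtain c where "v i = g * c" ..
      then have "x $ i = a $ i + of_int (m * c)" using g by (simp add: m(3) f_def b)
      then show ?thesis using a by (simp add: lattice_points_def)
    qed
    ultimately show "x \<in> closed_segment a b \<inter> lattice_points"
      by (simp add: lattice_points_def)
  qed
  moreover have "inj_on f {0..g}"
    using False g by (auto simp: inj_on_def f_def)
  ultimately show ?thesis
    using g by (simp add: card_image nat_add_distrib flip: g_def)
qed

text \<open>The faces of a simplex are the hulls of the subsets of its vertex set, and such a subset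
  spans dimension one iff it has two elements.\<close>

lemma edge_of_convex_hull_affine_independent:
  fixes S :: "'a::euclidean_space set"
  assumes "\<not> affine_dependent S"
  shows "e edge_of convex hull S \<longleftrightarrow> (\<exists>a\<in>S. \<exists>b\<in>S. a \<noteq> b \<and> e = closed_segment a b)"
proof -
  have "aff_dim C = 1 \<longleftrightarrow> card C = 2" if "C \<subseteq> S" for C
  proof -
    have "\<not> affine_dependent C" using assms affine_dependent_subset that by blast
    then have "int (card C) = aff_dim C + 1" by (rule aff_dim_affine_independent)
    then show ?thesis by linarith
  qed
  then have "e edge_of convex hull S \<longleftrightarrow> (\<exists>C\<subseteq>S. card C = 2 \<and> e = convex hull C)"
    unfolding edge_of_def face_of_convex_hull_affine_independent[OF assms]
    by (auto simp: aff_dim_convex_hull)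
  also have "\<dots> \<longleftrightarrow> (\<exists>a\<in>S. \<exists>b\<in>S. a \<noteq> b \<and> e = closed_segment a b)"
  proof safe
    fix C assume "C \<subseteq> S" "card C = 2"
    then obtain a b where "C = {a, b}" "a \<noteq> b" by (auto simp: card_2_iff)
    with \<open>C \<subseteq> S\<close> show "\<exists>a\<in>S. \<exists>b\<in>S. a \<noteq> b \<and> convex hull C = closed_segment a b"
      by (auto simp: segment_convex_hull)
  next
    fix a b assume "a \<in> S" "b \<in> S" "a \<noteq> b"
    then show "\<exists>C\<subseteq>S. card C = 2 \<and> closed_segment a b = convex hull C"
      by (intro exI[of _ "{a, b}"]) (simp add: segment_convex_hull)
  qed
  finally show ?thesis .
qed

text \<open>Positivity keeps the scaled axis vectors nonzero; being pairwise orthogonal, they are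
  then linearly independent, and adjoining the origin to a linearly independent set yields an
  affinely independent one. This makes the description of the edges of a simplex available for
  \<open>rect_simplex\<close>.\<close>

lemma affine_independent_rect_simplex_vertices:
  fixes l :: "nat ^ 'n"
  assumes "\<And>i. l $ i > 0"
  shows "\<not> affine_dependent (insert 0 (range (\<lambda>i. real (l $ i) *\<^sub>R axis i 1 :: real ^ 'n)))"
proof -
  have nz: "real (l $ i) *\<^sub>R axis i 1 \<noteq> (0 :: real ^ 'n)" for i
    using assms[of i] by (simp add: axis_eq_0_iff)
  have "pairwise orthogonal (range (\<lambda>i. real (l $ i) *\<^sub>R axis i 1 :: real ^ 'n))"
    by (auto simp: pairwise_def orthogonal_def inner_axis_axis)
  moreover have "0 \<notin> range (\<lambda>i. real (l $ i) *\<^sub>R axis i 1 :: real ^ 'n)"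
    unfolding image_iff using nz[symmetric] by blast
  ultimately have "independent (range (\<lambda>i. real (l $ i) *\<^sub>R axis i 1 :: real ^ 'n))"
    by (rule pairwise_orthogonal_independent)
  then show ?thesis by (rule contrapos_nn) (rule affine_dependent_imp_dependent2)
qed

lemma card_lattice_points_axis_edge:
  fixes l :: "nat ^ 'n"
  shows "card (closed_segment 0 (real (l $ i) *\<^sub>R axis i 1 :: real ^ 'n) \<inter> lattice_points)
    = Suc (l $ i)"
proof -
  define v :: "'n \<Rightarrow> int" where "v h = (if h = i then int (l $ i) else 0)" for h
  \<comment> \<open>For nonzero \<open>l $ i\<close>, the set \<open>range v\<close> contains 0 only
    if there is an index besides \<open>i\<close>. Adjoining 0 leaves the Gcd unchanged and avoids a
    separate treatment of dimension one.\<close>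
  have "insert 0 (range v) = {0, int (l $ i)}" by (auto simp: v_def)
  then have "Gcd (insert 0 (range v)) = Gcd {0, int (l $ i)}" by simp
  then have "Gcd (range v) = int (l $ i)" by simp
  moreover have "card (closed_segment 0 (real (l $ i) *\<^sub>R axis i 1 :: real ^ 'n) \<inter> lattice_points)
    = Suc (nat (Gcd (range v)))"
    by (rule card_lattice_points_closed_segment) (auto simp: lattice_points_def v_def axis_def)
  ultimately show ?thesis by simp
qed

lemma card_lattice_points_skew_edge:
  fixes l :: "nat ^ 'n"
  assumes "i \<noteq> j"
  shows "card (closed_segment (real (l $ i) *\<^sub>R axis i 1 :: real ^ 'n) (real (l $ j) *\<^sub>R axis j 1)
    \<inter> lattice_points) = Suc (gcd (l $ i) (l $ j))"
proof -
  \<comment> \<open>These are the coordinates of the second endpoint minus the first; the Gcd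
    ignores the sign at \<open>i\<close>.\<close>
  define v :: "'n \<Rightarrow> int"
    where "v h = (if h = i then - int (l $ i) else if h = j then int (l $ j) else 0)" for h
  \<comment> \<open>Adjoining 0 again makes the computation uniform, now including dimension two,
    where \<open>i\<close> and \<open>j\<close> are the only indices.\<close>
  have "insert 0 (range v) = {0, - int (l $ i), int (l $ j)}" using assms by (auto simp: v_def)
  then have "Gcd (insert 0 (range v)) = Gcd {0, - int (l $ i), int (l $ j)}" by simp
  then have "Gcd (range v) = int (gcd (l $ i) (l $ j))" by simp
  moreover have "card (closed_segment (real (l $ i) *\<^sub>R axis i 1 :: real ^ 'n)
      (real (l $ j) *\<^sub>R axis j 1) \<inter> lattice_points) = Suc (nat (Gcd (range v)))"
    using assms
    by (intro card_lattice_points_closed_segment) (auto simp: lattice_points_def v_def axis_def)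
  ultimately show ?thesis by simp
qed

lemma lattice_polytope_rect_simplex: "lattice_polytope (rect_simplex l)"
  unfolding lattice_polytope_def rect_simplex_def
  by (intro exI[of _ "insert 0 (range (\<lambda>i. real (l $ i) *\<^sub>R axis i 1))"])
    (auto simp: lattice_points_def axis_def)

theorem proposition3p12:
  fixes k :: nat and l :: "nat ^ 'n"
  assumes "k > 0" and "\<And>i. l $ i > 0"
  shows "LPE k (rect_simplex l) \<longleftrightarrow> (\<forall>i j. gcd (l $ i) (l $ j) \<ge> k - 1)"
proof -
  define p :: "'n \<Rightarrow> real ^ 'n" where "p i = real (l $ i) *\<^sub>R axis i 1" for i
  have nz: "p i \<noteq> 0" for i using assms(2)[of i] by (simp add: p_def axis_eq_0_iff)
  have p_eq: "p i = p j \<longleftrightarrow> i = j" for i j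
    using assms(2) by (auto simp: p_def vec_eq_iff axis_def)
  have edge: "e edge_of rect_simplex l \<longleftrightarrow>
    (\<exists>i. e = closed_segment 0 (p i)) \<or> (\<exists>i j. i \<noteq> j \<and> e = closed_segment (p i) (p j))" for e
  proof -
    have "\<not> affine_dependent (insert 0 (range p))"
      using affine_independent_rect_simplex_vertices[OF assms(2)] by (simp add: p_def[abs_def])
    moreover have "rect_simplex l = convex hull (insert 0 (range p))"
      by (simp add: rect_simplex_def p_def[abs_def])
    ultimately have "e edge_of rect_simplex l \<longleftrightarrow>
        (\<exists>a\<in>insert 0 (range p). \<exists>b\<in>insert 0 (range p). a \<noteq> b \<and> e = closed_segment a b)"
      by (simp add: edge_of_convex_hull_affine_independent)
    \<comment> \<open>Ordered pairs of distinct vertices are split by the position of the origin.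
      The two orientations of an axis edge are merged afterwards by the symmetry of
      segments.\<close>
    also have "\<dots> \<longleftrightarrow> (\<exists>i. e = closed_segment 0 (p i)) \<or> (\<exists>i. e = closed_segment (p i) 0) \<or>
        (\<exists>i j. i \<noteq> j \<and> e = closed_segment (p i) (p j))"
      by (simp add: nz nz[symmetric] p_eq ex_disj_distrib)
    finally show ?thesis by (auto simp: closed_segment_commute)
  qed
  have card_axis: "card (closed_segment 0 (p i) \<inter> lattice_points) = Suc (l $ i)" for i
    unfolding p_def by (rule card_lattice_points_axis_edge)
  have card_skew: "card (closed_segment (p i) (p j) \<inter> lattice_points) = Suc (gcd (l $ i) (l $ j))"
    if "i \<noteq> j" for i j
    unfolding p_def using that by (rule card_lattice_points_skew_edge)
  have "LPE k (rect_simplex l) \<longleftrightarrow>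
      (\<forall>i. k \<le> card (closed_segment 0 (p i) \<inter> lattice_points)) \<and>
      (\<forall>i j. i \<noteq> j \<longrightarrow> k \<le> card (closed_segment (p i) (p j) \<inter> lattice_points))"
    by (auto simp: LPE_def edge lattice_polytope_rect_simplex)
  also have "\<dots> \<longleftrightarrow>
      (\<forall>i. k \<le> Suc (l $ i)) \<and> (\<forall>i j. i \<noteq> j \<longrightarrow> k \<le> Suc (gcd (l $ i) (l $ j)))"
    using card_axis card_skew by simp
  \<comment> \<open>The diagonal instances \<open>i = j\<close> stand for the axis edges, since
    \<open>gcd (l $ i) (l $ i) = l $ i\<close>; the others stand for the edges between two axis
    vertices.\<close>
  also have "\<dots> \<longleftrightarrow> (\<forall>i j. k \<le> Suc (gcd (l $ i) (l $ j)))" (is "?L \<longleftrightarrow> ?R")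
  proof
    assume ?L
    then have "k \<le> Suc (gcd (l $ i) (l $ j))" for i j by (cases "i = j") simp_all
    then show ?R by blast
  next
    assume R: ?R
    have "k \<le> Suc (l $ i)" for i using R[rule_format, of i i] by simp
    then show ?L using R by blast
  qed
  \<comment> \<open>For truncated subtraction on naturals, \<open>k - 1 \<le> m\<close> is
    equivalent to \<open>k \<le> Suc m\<close>; the shift by one is the excess of lattice points
    over lattice steps on an edge.\<close>
  finally show ?thesis by (simp add: le_diff_conv)
qed

end
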